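(* Let $U$ be a unitary operator on a Hilbert space $\mathcal{H}$ such that $\mathcal{H}$ is generated by the eigenvectors of $U$ (the almost periodic case). Then for each $A\in\mathcal{B}(\mathcal{H})$, $$\frac{1}{N}\sum_{n=0}^{N-1}U^{n}AU^{n}\longrightarrow S_A$$ in the strong operator topology as $N\to\infty$.
   Context: $\mathcal{B}(\mathcal{H})$ denotes the bounded operators on the (complex) Hilbert space $\mathcal{H}$. "$\mathcal{H}$ is generated by the eigenvectors of $U$" means that the closed linear span of the eigenvectors of $U$ is $\mathcal{H}$. Let $\mathbb{T}$ be the unit circle, $\sigma_{\mathrm{pp}}(U)=\{z\in\mathbb{T} : z \text{ is an eigenvalue of } U\}$, and $\sigma_{\mathrm{pp}}^{\mathrm{a}}(U)=\{z\in\sigma_{\mathrm{pp}}(U) : zw=1\text{ for some }w\in\sigma_{\mathrm{pp}}(U)\}$. For $z\in\sigma_{\mathrm{pp}}(U)$, $E_z$ is the orthogonal projection onto the eigenspace of $U$ for the eigenvalue $z$. For $A\in\mathcal{B}(\mathcal{H})$, $S_A=\sum_{z\in\sigma_{\mathrm{pp}}^{\mathrm{a}}(U)}E_zAE_{\bar z}$ denotes the limit in the strong operator topology (which exists) of the net of sums $\sum_{z\in F}E_zAE_{\bar z}$, indexed by the finite subsets $F$ of $\sigma_{\mathrm{pp}}^{\mathrm{a}}(U)$ directed by inclusion. *)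

theory Defs
  imports "HOL-Analysis.Analysis"
begin

text \<open>
  Complex Hilbert spaces. The inner product is conjugate-linear in the first argument and
  linear in the second one. Completeness and the underlying real structure come from
  \<^class>\<open>banach\<close>; \<open>scaleC_of_real\<close> and \<open>norm_eq_sqrt_cinner\<close> tie them to the complex structure,
  so that bounded operators and their strong topology are those of HOL-Analysis.
\<close>

class complex_hilbert_space = banach +
  fixes scaleC :: "complex \<Rightarrow> 'a \<Rightarrow> 'a"  (infixr \<open>*\<^sub>C\<close> 75)
    and cinner :: "'a \<Rightarrow> 'a \<Rightarrow> complex"
  assumes scaleC_add_right: "a *\<^sub>C (x + y) = a *\<^sub>C x + a *\<^sub>C y"
    and scaleC_add_left: "(a + b) *\<^sub>C x = a *\<^sub>C x + b *\<^sub>C x"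
    and scaleC_scaleC: "a *\<^sub>C b *\<^sub>C x = (a * b) *\<^sub>C x"
    and scaleC_of_real: "complex_of_real r *\<^sub>C x = r *\<^sub>R x"
    and cinner_commute: "cinner x y = cnj (cinner y x)"
    and cinner_add_right: "cinner x (y + z) = cinner x y + cinner x z"
    and cinner_scaleC_right: "cinner x (a *\<^sub>C y) = a * cinner x y"
    and cinner_nonneg: "0 \<le> Re (cinner x x)"
    and cinner_eq_zero_iff: "cinner x x = 0 \<longleftrightarrow> x = 0"
    and norm_eq_sqrt_cinner: "norm x = sqrt (Re (cinner x x))"

instantiation complex :: complex_hilbert_space
begin

definition scaleC_complex :: "complex \<Rightarrow> complex \<Rightarrow> complex" where
  "scaleC_complex a x = a * x"

definition cinner_complex :: "complex \<Rightarrow> complex \<Rightarrow> complex" where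
  "cinner_complex x y = cnj x * y"

instance
  by standard
    (auto simp: scaleC_complex_def cinner_complex_def algebra_simps scaleR_conv_of_real
      cmod_def power2_eq_square)

end

lemma vector_space_scaleC:
  "vector_space (scaleC :: complex \<Rightarrow> 'a::complex_hilbert_space \<Rightarrow> 'a)"
proof
  fix x :: 'a
  show "1 *\<^sub>C x = x"
    using scaleC_of_real[of 1 x] by simp
qed (simp_all add: scaleC_add_right scaleC_add_left scaleC_scaleC)

text \<open>
  The type \<open>'a \<Rightarrow>\<^sub>L 'a\<close> consists of the bounded real-linear operators; the bounded operators on the
  complex Hilbert space are the complex-linear ones among them.
\<close>

definition bounded_operators :: "('a::complex_hilbert_space \<Rightarrow>\<^sub>L 'a) set" where
  "bounded_operators = {A. \<forall>c x. blinfun_apply A (c *\<^sub>C x) = c *\<^sub>C blinfun_apply A x}"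

definition is_adjoint ::
    "('a::complex_hilbert_space \<Rightarrow>\<^sub>L 'a) \<Rightarrow> ('a \<Rightarrow>\<^sub>L 'a) \<Rightarrow> bool" where
  "is_adjoint A B \<longleftrightarrow>
     (\<forall>x y. cinner (blinfun_apply A x) y = cinner x (blinfun_apply B y))"

definition unitary_operator :: "('a::complex_hilbert_space \<Rightarrow>\<^sub>L 'a) \<Rightarrow> bool" where
  "unitary_operator U \<longleftrightarrow> U \<in> bounded_operators \<and>
     (\<exists>V\<in>bounded_operators. is_adjoint U V \<and> V o\<^sub>L U = id_blinfun \<and> U o\<^sub>L V = id_blinfun)"

definition blinfun_power ::
    "('a::real_normed_vector \<Rightarrow>\<^sub>L 'a) \<Rightarrow> nat \<Rightarrow> ('a \<Rightarrow>\<^sub>L 'a)" where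
  "blinfun_power A n = (((o\<^sub>L) A) ^^ n) id_blinfun"

definition eigenspace :: "('a::complex_hilbert_space \<Rightarrow>\<^sub>L 'a) \<Rightarrow> complex \<Rightarrow> 'a set" where
  "eigenspace U z = {x. blinfun_apply U x = z *\<^sub>C x}"

definition eigenvectors :: "('a::complex_hilbert_space \<Rightarrow>\<^sub>L 'a) \<Rightarrow> 'a set" where
  "eigenvectors U = {x. x \<noteq> 0 \<and> (\<exists>z. x \<in> eigenspace U z)}"

definition generated_by_eigenvectors :: "('a::complex_hilbert_space \<Rightarrow>\<^sub>L 'a) \<Rightarrow> bool" where
  "generated_by_eigenvectors U \<longleftrightarrow> closure (module.span scaleC (eigenvectors U)) = UNIV"

definition sigma_pp :: "('a::complex_hilbert_space \<Rightarrow>\<^sub>L 'a) \<Rightarrow> complex set" where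
  "sigma_pp U = {z \<in> sphere 0 1. \<exists>x. x \<noteq> 0 \<and> x \<in> eigenspace U z}"

definition sigma_pp_a :: "('a::complex_hilbert_space \<Rightarrow>\<^sub>L 'a) \<Rightarrow> complex set" where
  "sigma_pp_a U = {z \<in> sigma_pp U. \<exists>w\<in>sigma_pp U. z * w = 1}"

text \<open>
  Meaningful for a closed complex subspace \<open>M\<close>, where the projection theorem gives
  existence and uniqueness.
\<close>

definition orthogonal_projection :: "'a::complex_hilbert_space set \<Rightarrow> ('a \<Rightarrow>\<^sub>L 'a)" where
  "orthogonal_projection M =
     (THE P. \<forall>x. blinfun_apply P x \<in> M \<and> (\<forall>y\<in>M. cinner y (x - blinfun_apply P x) = 0))"

definition eigenprojection ::
    "('a::complex_hilbert_space \<Rightarrow>\<^sub>L 'a) \<Rightarrow> complex \<Rightarrow> ('a \<Rightarrow>\<^sub>L 'a)" where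
  "eigenprojection U z = orthogonal_projection (eigenspace U z)"

definition S_partial ::
    "('a::complex_hilbert_space \<Rightarrow>\<^sub>L 'a) \<Rightarrow> ('a \<Rightarrow>\<^sub>L 'a) \<Rightarrow> complex set \<Rightarrow> ('a \<Rightarrow>\<^sub>L 'a)" where
  "S_partial U A F = (\<Sum>z\<in>F. eigenprojection U z o\<^sub>L A o\<^sub>L eigenprojection U (cnj z))"

definition S_op ::
    "('a::complex_hilbert_space \<Rightarrow>\<^sub>L 'a) \<Rightarrow> ('a \<Rightarrow>\<^sub>L 'a) \<Rightarrow> ('a \<Rightarrow>\<^sub>L 'a)" where
  "S_op U A = (THE S. limitin strong_operator_topology (S_partial U A) S
     (finite_subsets_at_top (sigma_pp_a U)))"

end

theory Submission
  imports Defs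
begin

text \<open>
  On an eigenvector \<open>x\<close> with eigenvalue \<open>w\<close> the averages reduce to the ergodic means
  \<open>(1/N) \<Sum>n<N. w\<^sup>n U\<^sup>n (A x)\<close>. These converge for every vector: on eigenvectors they are geometric
  sums, and they are contractions. Their limit is the orthogonal projection onto the eigenspace of
  \<open>cnj w\<close>, which also yields the existence of the eigenprojections without the projection
  theorem. The partial sums of \<open>S\<^sub>A\<close> have norm at most \<open>\<parallel>A\<parallel>\<close> by Pythagoras and Bessel, and on \<open>x\<close>
  they are eventually equal to \<open>E\<^bsub>cnj w\<^esub> A x\<close>. So both nets are equibounded and have the same limit
  on a total set.
\<close>

section \<open>Complex inner products\<close>

lemma module_scaleC: "module (scaleC :: complex \<Rightarrow> 'a::complex_hilbert_space \<Rightarrow> 'a)"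
  using vector_space_scaleC by (simp add: vector_space_def module_def)

lemmas scaleC_one [simp] = module.scale_one[OF module_scaleC]
  and scaleC_zero_left [simp] = module.scale_zero_left[OF module_scaleC]
  and scaleC_zero_right [simp] = module.scale_zero_right[OF module_scaleC]
  and scaleC_diff_right = module.scale_right_diff_distrib[OF module_scaleC]
  and scaleC_sum_left = module.scale_sum_left[OF module_scaleC]

lemma scaleC_scaleR_commute: "c *\<^sub>C (r *\<^sub>R x) = r *\<^sub>R (c *\<^sub>C (x :: 'a::complex_hilbert_space))"
  by (simp flip: scaleC_of_real add: scaleC_scaleC mult.commute)

lemma cinner_add_left: "cinner (x + y) z = cinner x z + cinner y z"
  by (subst (1 2 3) cinner_commute) (simp add: cinner_add_right)

lemma cinner_scaleC_left: "cinner (a *\<^sub>C x) y = cnj a * cinner x y"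
  by (subst (1 2) cinner_commute) (simp add: cinner_scaleC_right)

lemma additive_cinner_right: "Modules.additive (cinner x)"
  by standard (rule cinner_add_right)

lemma additive_cinner_left: "Modules.additive (\<lambda>x. cinner x y)"
  by standard (rule cinner_add_left)

lemmas cinner_zero_right [simp] = Modules.additive.zero[OF additive_cinner_right]
  and cinner_diff_right = Modules.additive.diff[OF additive_cinner_right]
  and cinner_sum_right = Modules.additive.sum[OF additive_cinner_right]
  and cinner_sum_left = Modules.additive.sum[OF additive_cinner_left]

lemma norm_power2_cinner: "(norm x)\<^sup>2 = Re (cinner x x)"
  by (simp add: norm_eq_sqrt_cinner cinner_nonneg)

lemma norm_scaleC: "norm (c *\<^sub>C x) = cmod c * norm (x :: 'a::complex_hilbert_space)"
proof -
  have "(norm (c *\<^sub>C x))\<^sup>2 = Re (c * cnj c * cinner x x)"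
    by (simp add: norm_power2_cinner cinner_scaleC_left cinner_scaleC_right mult_ac)
  also have "\<dots> = (cmod c * norm x)\<^sup>2"
    by (simp add: complex_norm_square[symmetric] norm_power2_cinner power_mult_distrib
        flip: of_real_power)
  finally show ?thesis by (simp add: power2_eq_iff_nonneg)
qed

lemma bounded_linear_scaleC_right:
  "bounded_linear ((*\<^sub>C) c :: 'a \<Rightarrow> 'a::complex_hilbert_space)"
  by (rule bounded_linear_intro[where K = "cmod c"])
    (simp_all add: scaleC_add_right scaleC_scaleR_commute norm_scaleC mult.commute)

lemma tendsto_scaleC_left:
  fixes x :: "'a::complex_hilbert_space"
  assumes "(f \<longlongrightarrow> c) F"
  shows "((\<lambda>i. f i *\<^sub>C x) \<longlongrightarrow> c *\<^sub>C x) F"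
proof -
  have "bounded_linear (\<lambda>c. c *\<^sub>C x)"
    by (rule bounded_linear_intro[where K = "norm x"])
      (simp_all add: scaleC_add_left norm_scaleC scaleC_scaleC scaleR_conv_of_real
        flip: scaleC_of_real)
  from bounded_linear.tendsto[OF this assms] show ?thesis .
qed

lemma norm_add_power2:
  "(norm (x + y))\<^sup>2 = (norm x)\<^sup>2 + (norm y)\<^sup>2 + 2 * Re (cinner x y)"
  for x y :: "'a::complex_hilbert_space"
  using arg_cong[OF cinner_commute[of y x], of Re]
  by (simp add: norm_power2_cinner cinner_add_left cinner_add_right)

text \<open>Polarization: the real part is a combination of squared norms, and the imaginary part
  is, up to sign, the real part taken at \<open>\<i> *\<^sub>C y\<close>. So continuity of the norm
  suffices.\<close>

lemma continuous_on_cinner_right: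
  fixes x :: "'a::complex_hilbert_space"
  shows "continuous_on S (cinner x)"
proof -
  have re: "Re (cinner x y) = ((norm (x + y))\<^sup>2 - (norm x)\<^sup>2 - (norm y)\<^sup>2) / 2" for y
    by (simp add: norm_add_power2)
  have im: "Im (cinner x y) = - Re (cinner x (\<i> *\<^sub>C y))" for y
    by (simp add: cinner_scaleC_right)
  have re_cont: "continuous_on T (\<lambda>y. Re (cinner x y))" for T
    unfolding re by (intro continuous_intros) simp
  have im_cont: "continuous_on S (\<lambda>y. Re (cinner x (\<i> *\<^sub>C y)))"
    by (rule continuous_on_compose2[OF re_cont[of UNIV]
          bounded_linear.continuous_on[OF bounded_linear_scaleC_right continuous_on_id]]) simp
  have "continuous_on S (\<lambda>y. Complex (Re (cinner x y)) (Im (cinner x y)))"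
    unfolding Complex_eq im
    by (intro continuous_on_add continuous_on_mult continuous_on_const continuous_on_of_real
        continuous_on_minus re_cont im_cont)
  then show ?thesis by simp
qed

lemma norm_sum_power2_orthogonal:
  fixes v :: "'i \<Rightarrow> 'a::complex_hilbert_space"
  assumes "finite I"
    and "\<And>i j. i \<in> I \<Longrightarrow> j \<in> I \<Longrightarrow> i \<noteq> j \<Longrightarrow> cinner (v i) (v j) = 0"
  shows "(norm (\<Sum>i\<in>I. v i))\<^sup>2 = (\<Sum>i\<in>I. (norm (v i))\<^sup>2)"
  using assms
proof (induction I)
  case (insert i I)
  have "cinner (v i) (\<Sum>j\<in>I. v j) = 0"
    using insert.hyps insert.prems unfolding cinner_sum_right by (intro sum.neutral) auto
  then show ?case
    using insert by (simp add: norm_add_power2)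
qed simp

section \<open>Equibounded nets of operators\<close>

text \<open>An epsilon/2 argument: a nearby \<open>y\<close> with limit 0 controls
  \<open>h i x\<close>, the error being at most \<open>C * norm (x - y)\<close>. The bound is only
  asked for eventually because partial sums over arbitrary index sets admit none.\<close>

lemma closed_tendsto_zero_equibounded:
  fixes h :: "'i \<Rightarrow> 'a::real_normed_vector \<Rightarrow> 'b::real_normed_vector"
  assumes lin: "\<And>i. linear (h i)"
    and bound: "\<forall>\<^sub>F i in F. \<forall>x. norm (h i x) \<le> C * norm x"
  shows "closed {x. ((\<lambda>i. h i x) \<longlongrightarrow> 0) F}"
proof -
  have "((\<lambda>i. h i x) \<longlongrightarrow> 0) F"
    if x: "x \<in> closure {x. ((\<lambda>i. h i x) \<longlongrightarrow> 0) F}" for x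
  proof (rule tendstoI)
    fix e :: real
    assume "e > 0"
    \<comment> \<open>Chosen so that \<open>(\<bar>C\<bar> + 1) * d = e / 2\<close>; the shift by 1
      and the absolute value make the denominator positive for every \<open>C\<close>.\<close>
    define d where "d = e / (2 * (\<bar>C\<bar> + 1))"
    have "d > 0" using \<open>e > 0\<close> by (simp add: d_def)
    then obtain y where y: "((\<lambda>i. h i y) \<longlongrightarrow> 0) F" "dist y x < d"
      using x unfolding closure_approachable by blast
    have "C * norm (x - y) \<le> (\<bar>C\<bar> + 1) * d"
      using y(2) \<open>d > 0\<close> by (intro mult_mono) (auto simp: dist_norm norm_minus_commute)
    also have "\<dots> = e / 2" by (simp add: d_def field_simps)
    finally have Cd: "C * norm (x - y) \<le> e / 2" .
    have "\<forall>\<^sub>F i in F. dist (h i y) 0 < e / 2"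
      using y(1) \<open>e > 0\<close> by (intro tendstoD) auto
    with bound show "\<forall>\<^sub>F i in F. dist (h i x) 0 < e"
    proof eventually_elim
      case (elim i)
      have "h i x = h i (x - y) + h i y"
        by (simp add: linear_diff[OF lin])
      then have "norm (h i x) \<le> norm (h i (x - y)) + norm (h i y)"
        by (metis norm_triangle_ineq)
      also have "\<dots> < e"
        using elim Cd by (smt (verit, best) dist_0_norm dist_commute field_sum_of_halves)
      finally show ?case by simp
    qed
  qed
  then show ?thesis
    unfolding closure_subset_eq[symmetric] by blast
qed

text \<open>In a Banach space convergence is the Cauchy property, that is, the double differences
  tend to 0 along the product filter. These are again linear and bounded, by \<open>2 * C\<close>,
  so the previous lemma applies.\<close>

lemma closed_convergent_equibounded:
  fixes h :: "nat \<Rightarrow> 'a::real_normed_vector \<Rightarrow> 'b::banach"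
  assumes lin: "\<And>i. linear (h i)"
    and bound: "\<And>i x. norm (h i x) \<le> C * norm x"
  shows "closed {x. convergent (\<lambda>i. h i x)}"
proof -
  have "convergent (\<lambda>i. h i x) \<longleftrightarrow>
      ((\<lambda>(m, n). h m x - h n x) \<longlongrightarrow> 0) (sequentially \<times>\<^sub>F sequentially)" for x
    unfolding Cauchy_convergent_iff[symmetric] Cauchy_iff tendsto_iff eventually_prod_sequentially
    by (auto simp: norm_minus_commute)
  moreover have "closed {x. ((\<lambda>i. h (fst i) x - h (snd i) x) \<longlongrightarrow> 0)
      (sequentially \<times>\<^sub>F sequentially)}"
  proof (rule closed_tendsto_zero_equibounded)
    show "linear (\<lambda>x. h (fst i) x - h (snd i) x)" for i
      by (intro linear_compose_sub lin)
    have "norm (h m x - h n x) \<le> (2 * C) * norm x" for m n x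
      using bound[of m x] bound[of n x] norm_triangle_ineq4[of "h m x" "h n x"] by linarith
    then show "\<forall>\<^sub>F i in sequentially \<times>\<^sub>F sequentially.
        \<forall>x. norm (h (fst i) x - h (snd i) x) \<le> (2 * C) * norm x"
      by simp
  qed
  ultimately show ?thesis by (simp add: case_prod_unfold)
qed

text \<open>Linearity and the common bound \<open>C\<close> both survive the pointwise limit, which
  is therefore a bounded operator.\<close>

lemma pointwise_limit_blinfun:
  fixes h :: "nat \<Rightarrow> 'a::real_normed_vector \<Rightarrow> 'b::real_normed_vector"
  assumes lin: "\<And>i. linear (h i)"
    and bound: "\<And>i x. norm (h i x) \<le> C * norm x"
    and conv: "\<And>x. convergent (\<lambda>i. h i x)"
  obtains S :: "'a \<Rightarrow>\<^sub>L 'b" where "\<And>x. (\<lambda>i. h i x) \<longlonglongrightarrow> blinfun_apply S x"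
proof -
  define g where "g x = lim (\<lambda>i. h i x)" for x
  have g: "(\<lambda>i. h i x) \<longlonglongrightarrow> g x" for x
    using conv[of x] unfolding g_def by (simp add: convergent_LIMSEQ_iff)
  have "bounded_linear g"
  proof (rule bounded_linear_intro[where K = C])
    show "g (x + y) = g x + g y" for x y
      using tendsto_add[OF g[of x] g[of y]]
      by (intro LIMSEQ_unique[OF g]) (simp add: linear_add[OF lin])
    show "g (r *\<^sub>R x) = r *\<^sub>R g x" for r x
      using tendsto_scaleR[OF tendsto_const g[of x]]
      by (intro LIMSEQ_unique[OF g]) (simp add: linear_cmul[OF lin])
    show "norm (g x) \<le> norm x * C" for x
      using bound[of _ x] by (intro LIMSEQ_le_const2[OF tendsto_norm[OF g]]) (auto simp: mult.commute)
  qed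
  then show thesis
    using g that[of "Blinfun g"] by (simp add: bounded_linear_Blinfun_apply)
qed

text \<open>The strong operator topology is the pullback under \<open>blinfun_apply\<close> of the
  product topology on functions, where convergence is componentwise.\<close>

lemma limitin_strong_operator_topology_iff:
  "limitin strong_operator_topology f l F \<longleftrightarrow>
    (\<forall>x. ((\<lambda>i. blinfun_apply (f i) x) \<longlongrightarrow> blinfun_apply l x) F)"
proof -
  have "limitin strong_operator_topology f l F \<longleftrightarrow>
      limitin euclidean (\<lambda>i. blinfun_apply (f i)) (blinfun_apply l) F"
    unfolding limitin_def strong_operator_topology_def
    by (auto simp: openin_pullback_topology topspace_pullback_topology)
  then show ?thesis
    by (simp add: limitin_componentwise flip: euclidean_product_topology)
qed

section \<open>Unitary operators generated by their eigenvectors\<close>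

lemma blinfun_power_0 [simp]: "blinfun_power U 0 = id_blinfun"
  by (simp add: blinfun_power_def)

lemma blinfun_power_Suc [simp]: "blinfun_power U (Suc n) = U o\<^sub>L blinfun_power U n"
  by (simp add: blinfun_power_def)

lemma S_partial_apply:
  "blinfun_apply (S_partial U A F) x = (\<Sum>z\<in>F. blinfun_apply (eigenprojection U z)
    (blinfun_apply A (blinfun_apply (eigenprojection U (cnj z)) x)))"
  by (simp add: S_partial_def blinfun.sum_left)

text \<open>Strong limits along a nontrivial filter are unique, so exhibiting any limit of the
  partial sums evaluates the \<open>THE\<close> in \<open>S_op\<close>.\<close>

lemma S_op_eqI:
  assumes S: "limitin strong_operator_topology (S_partial U A) S
    (finite_subsets_at_top (sigma_pp_a U))"
  shows "S_op U A = S"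
  unfolding S_op_def
proof (rule the_equality)
  fix T
  assume "limitin strong_operator_topology (S_partial U A) T
    (finite_subsets_at_top (sigma_pp_a U))"
  with S show "T = S"
    unfolding limitin_strong_operator_topology_iff
    by (blast intro: blinfun_eqI tendsto_unique[OF finite_subsets_at_top_neq_bot])
qed (rule S)

lemma norm_mean_le:
  fixes f :: "nat \<Rightarrow> 'a::real_normed_vector"
  assumes "\<And>n. norm (f n) \<le> C"
  shows "norm ((1 / real N) *\<^sub>R (\<Sum>n<N. f n)) \<le> C"
proof (cases "N = 0")
  case True
  \<comment> \<open>The empty mean is 0, and \<open>C\<close> is nonnegative because it bounds a
    norm.\<close>
  then show ?thesis using order_trans[OF norm_ge_zero assms[of 0]] by simp
next
  case False
  have "norm (\<Sum>n<N. f n) \<le> real N * C"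
    using sum_norm_le[of "{..<N}" f "\<lambda>_. C"] assms by simp
  then show ?thesis using False by (simp add: field_simps)
qed

text \<open>For \<open>q \<noteq> 1\<close> the sum has the closed form
  \<open>(q ^ N - 1) / (q - 1)\<close>, of modulus at most \<open>2 / cmod (q - 1)\<close>, so
  dividing by \<open>N\<close> sends it to 0.\<close>

lemma tendsto_geometric_mean:
  fixes q :: complex
  assumes "cmod q = 1"
  shows "(\<lambda>N. (1 / of_nat N) * (\<Sum>n<N. q ^ n)) \<longlonglongrightarrow> (if q = 1 then 1 else 0)"
proof (cases "q = 1")
  case True
  \<comment> \<open>Only eventually: the mean at \<open>N = 0\<close> is 0, not 1.\<close>
  have "\<forall>\<^sub>F N in sequentially. 1 = (1 / of_nat N) * (\<Sum>n<N. q ^ n)"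
    using eventually_gt_at_top[of 0] by eventually_elim (simp add: True)
  then show ?thesis using True by (simp add: tendsto_eventually eventually_mono)
next
  case False
  have "(\<lambda>N. (1 / of_nat N) * (\<Sum>n<N. q ^ n)) \<longlonglongrightarrow> 0"
  proof (rule Lim_null_comparison)
    show "\<forall>\<^sub>F N in sequentially. norm ((1 / of_nat N) * (\<Sum>n<N. q ^ n))
        \<le> (2 / cmod (q - 1)) * (1 / real N)"
    proof (intro always_eventually allI)
      fix N
      have "cmod (q ^ N - 1) \<le> 2"
        using norm_triangle_ineq4[of "q ^ N" 1] assms by (simp add: norm_power)
      then show "norm ((1 / of_nat N) * (\<Sum>n<N. q ^ n)) \<le> (2 / cmod (q - 1)) * (1 / real N)"
        using False by (simp add: geometric_sum norm_mult norm_divide divide_right_mono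
            mult.commute flip: divide_divide_eq_left)
    qed
    show "(\<lambda>N. (2 / cmod (q - 1)) * (1 / real N)) \<longlonglongrightarrow> 0"
      by (intro tendsto_mult_right_zero lim_1_over_n)
  qed
  then show ?thesis using False by simp
qed

locale almost_periodic =
  fixes U :: "'a::complex_hilbert_space \<Rightarrow>\<^sub>L 'a"
  assumes unitary: "unitary_operator U"
    and generated: "generated_by_eigenvectors U"
begin

lemma U_scaleC: "blinfun_apply U (c *\<^sub>C x) = c *\<^sub>C blinfun_apply U x"
  using unitary by (simp add: unitary_operator_def bounded_operators_def)

lemma cinner_U: "cinner (blinfun_apply U x) (blinfun_apply U y) = cinner x y"
proof -
  obtain V where "is_adjoint U V" "V o\<^sub>L U = id_blinfun"
    using unitary by (auto simp: unitary_operator_def)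
  then show ?thesis
    by (metis is_adjoint_def blinfun_apply_blinfun_compose blinfun_apply_id_blinfun)
qed

lemma norm_U [simp]: "norm (blinfun_apply U x) = norm x"
  by (simp add: norm_eq_sqrt_cinner cinner_U)

lemma norm_blinfun_power [simp]: "norm (blinfun_apply (blinfun_power U n) x) = norm x"
  by (induction n) simp_all

lemma blinfun_power_scaleC:
  "blinfun_apply (blinfun_power U n) (c *\<^sub>C x) = c *\<^sub>C blinfun_apply (blinfun_power U n) x"
  by (induction n) (simp_all add: U_scaleC)

lemma blinfun_power_eigenspace:
  "x \<in> eigenspace U z \<Longrightarrow> blinfun_apply (blinfun_power U n) x = z ^ n *\<^sub>C x"
  by (induction n) (simp_all add: eigenspace_def U_scaleC scaleC_scaleC mult.commute)

lemma eigenspace_scaleC: "x \<in> eigenspace U z \<Longrightarrow> c *\<^sub>C x \<in> eigenspace U z"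
  by (simp add: eigenspace_def U_scaleC scaleC_scaleC mult.commute)

lemma eigenspace_diff: "x \<in> eigenspace U z \<Longrightarrow> y \<in> eigenspace U z \<Longrightarrow> x - y \<in> eigenspace U z"
  by (simp add: eigenspace_def blinfun.diff_right scaleC_diff_right)

lemma zero_in_eigenspace [simp]: "0 \<in> eigenspace U z"
  by (simp add: eigenspace_def blinfun.zero_right)

lemma cmod_eigenvalue:
  assumes "x \<in> eigenspace U z" "x \<noteq> 0"
  shows "cmod z = 1"
  using norm_U[of x] assms by (simp add: eigenspace_def norm_scaleC del: norm_U)

text \<open>Invariance of the inner product under \<open>U\<close> multiplies
  \<open>cinner x y\<close> by \<open>cnj z * w\<close>. Since \<open>cnj z\<close> is the inverse
  of \<open>z\<close>, this factor differs from 1. The zero vectors are split off because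
  \<open>cmod z = 1\<close> is only known for genuine eigenvectors.\<close>

lemma eigenspaces_orthogonal:
  assumes "x \<in> eigenspace U z" "y \<in> eigenspace U w" "z \<noteq> w"
  shows "cinner x y = 0"
proof (cases "x = 0 \<or> y = 0")
  case True
  then show ?thesis using cinner_commute[of x y] by auto
next
  case False
  then have z: "z * cnj z = 1"
    using assms cmod_eigenvalue[of x z] by (simp add: complex_norm_square[symmetric])
  have "cinner x y = cnj z * w * cinner x y"
    using cinner_U[of x y] assms
    by (simp add: eigenspace_def cinner_scaleC_left cinner_scaleC_right mult_ac)
  moreover have "cnj z * w \<noteq> 1"
    using z assms(3) by (metis mult.assoc mult.commute mult_1)
  ultimately show ?thesis by (metis mult_cancel_right1)
qed

text \<open>The density argument as an induction rule. Eigenspaces absorb scalars, so additivity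
  carries \<open>P\<close> from eigenspaces to the span, and closedness carries it to the whole
  space.\<close>

lemma closed_additive_induct [consumes 0, case_names closed add eigen]:
  assumes "closed {x. P x}"
    and "\<And>x y. P x \<Longrightarrow> P y \<Longrightarrow> P (x + y)"
    and "\<And>x z. cmod z = 1 \<Longrightarrow> x \<in> eigenspace U z \<Longrightarrow> P x"
  shows "P x"
proof -
  have "P x" if "x \<in> module.span scaleC (eigenvectors U)" for x
    using that
  proof (induction rule: module.span_induct_alt[OF module_scaleC, consumes 1])
    case 1
    \<comment> \<open>The zero vector lies in the eigenspace of 1, whether or not 1 is an
      eigenvalue.\<close>
    show ?case using assms(3)[of 1 0] by simp
  next
    case (2 c x y)
    then obtain z where "x \<in> eigenspace U z" "cmod z = 1"
      by (auto simp: eigenvectors_def dest: cmod_eigenvalue)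
    with 2 show ?case
      by (blast intro: assms(2,3) eigenspace_scaleC)
  qed
  then have "closure (module.span scaleC (eigenvectors U)) \<subseteq> {x. P x}"
    using assms(1) by (intro closure_minimal) auto
  then show ?thesis
    using generated by (auto simp: generated_by_eigenvectors_def)
qed

section \<open>Ergodic means of the powers of \<open>U\<close> weighted by a unimodular
  number\<close>

definition ergodic_mean :: "complex \<Rightarrow> nat \<Rightarrow> 'a \<Rightarrow> 'a" where
  "ergodic_mean z N x = (1 / real N) *\<^sub>R (\<Sum>n<N. z ^ n *\<^sub>C blinfun_apply (blinfun_power U n) x)"

lemma linear_ergodic_mean: "linear (ergodic_mean z N)"
  by (rule linearI)
    (simp_all add: ergodic_mean_def blinfun.add_right blinfun.scaleR_right scaleC_add_right
      sum.distrib scaleR_add_right scaleC_scaleR_commute scaleR_sum_right mult.commute)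

text \<open>The factor 1 keeps the shape \<open>C * norm x\<close> expected by the lemmas on
  equibounded sequences.\<close>

lemma norm_ergodic_mean:
  "cmod z = 1 \<Longrightarrow> norm (ergodic_mean z N x) \<le> 1 * norm x"
  unfolding ergodic_mean_def by (rule norm_mean_le) (simp add: norm_scaleC norm_power)

text \<open>On the eigenspace of \<open>w\<close> the mean is multiplication by the geometric mean
  of ratio \<open>z * w\<close>.\<close>

lemma ergodic_mean_eigenspace:
  assumes "x \<in> eigenspace U w" "cmod z = 1" "cmod w = 1"
  shows "(\<lambda>N. ergodic_mean z N x) \<longlonglongrightarrow> (if z * w = 1 then x else 0)"
proof -
  have "ergodic_mean z N x = ((1 / of_nat N) * (\<Sum>n<N. (z * w) ^ n)) *\<^sub>C x" for N
  proof -
    have "ergodic_mean z N x = (1 / real N) *\<^sub>R ((\<Sum>n<N. (z * w) ^ n) *\<^sub>C x)"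
      using assms(1)
      by (simp add: ergodic_mean_def blinfun_power_eigenspace scaleC_scaleC scaleC_sum_left
          power_mult_distrib)
    then show ?thesis by (simp add: scaleC_scaleC flip: scaleC_of_real)
  qed
  moreover have "(\<lambda>N. ((1 / of_nat N) * (\<Sum>n<N. (z * w) ^ n)) *\<^sub>C x)
      \<longlonglongrightarrow> (if z * w = 1 then 1 else 0) *\<^sub>C x"
    using assms by (intro tendsto_scaleC_left tendsto_geometric_mean) (simp add: norm_mult)
  ultimately show ?thesis by (simp split: if_splits)
qed

text \<open>Von Neumann's mean ergodic theorem in the almost periodic case: the means are
  contractions that converge on the eigenvectors.\<close>

lemma convergent_ergodic_mean:
  assumes "cmod z = 1"
  shows "convergent (\<lambda>N. ergodic_mean z N x)"
proof (induction x rule: closed_additive_induct)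
  case closed
  show ?case
    by (rule closed_convergent_equibounded[OF linear_ergodic_mean norm_ergodic_mean[OF assms]])
next
  case (add x y)
  then show ?case
    using convergent_add by (simp add: linear_add[OF linear_ergodic_mean])
next
  case (eigen x w)
  then show ?case using ergodic_mean_eigenspace assms unfolding convergent_def by blast
qed

section \<open>Eigenprojections as limits of ergodic means\<close>

lemma eigenprojection_eqI:
  assumes P: "\<And>x. blinfun_apply P x \<in> eigenspace U z"
    and orth: "\<And>x y. y \<in> eigenspace U z \<Longrightarrow> cinner y (x - blinfun_apply P x) = 0"
  shows "eigenprojection U z = P"
  unfolding eigenprojection_def orthogonal_projection_def
proof (rule the_equality)
  fix Q
  assume Q: "\<forall>x. blinfun_apply Q x \<in> eigenspace U z \<and>
    (\<forall>y\<in>eigenspace U z. cinner y (x - blinfun_apply Q x) = 0)"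
  show "Q = P"
  proof (rule blinfun_eqI)
    fix x
    let ?d = "blinfun_apply Q x - blinfun_apply P x"
    \<comment> \<open>The difference of two candidates lies in the eigenspace and is orthogonal to
      it, hence to itself.\<close>
    have "?d \<in> eigenspace U z" using P Q by (auto intro: eigenspace_diff)
    then have "cinner ?d (x - blinfun_apply P x) - cinner ?d (x - blinfun_apply Q x) = 0"
      using orth Q by simp
    then have "cinner ?d ?d = 0" by (simp add: cinner_diff_right)
    then show "blinfun_apply Q x = blinfun_apply P x" by (simp add: cinner_eq_zero_iff)
  qed
qed (use P orth in auto)

text \<open>The limit \<open>P\<close> of the means with weight \<open>cnj z\<close> fixes the
  eigenspace of \<open>z\<close> and kills the other eigenspaces. Having range in the eigenspace and
  having residual orthogonal to it are closed additive conditions on \<open>x\<close>, so both hold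
  everywhere, and uniqueness gives \<open>P = eigenprojection U z\<close>.\<close>

lemma
  assumes "cmod z = 1"
  shows ergodic_mean_tendsto_eigenprojection:
      "(\<lambda>N. ergodic_mean (cnj z) N x) \<longlonglongrightarrow> blinfun_apply (eigenprojection U z) x"
    and eigenprojection_in_eigenspace: "blinfun_apply (eigenprojection U z) x \<in> eigenspace U z"
    and eigenprojection_orthogonal:
      "y \<in> eigenspace U z \<Longrightarrow> cinner y (x - blinfun_apply (eigenprojection U z) x) = 0"
proof -
  have cz: "cmod (cnj z) = 1" using assms by simp
  obtain P :: "'a \<Rightarrow>\<^sub>L 'a" where P: "\<And>x. (\<lambda>N. ergodic_mean (cnj z) N x) \<longlonglongrightarrow> blinfun_apply P x"
    using pointwise_limit_blinfun[OF linear_ergodic_mean norm_ergodic_mean[OF cz]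
        convergent_ergodic_mean[OF cz]] by blast
  \<comment> \<open>The geometric ratio is 1 exactly at \<open>w = z\<close>, since
    \<open>cnj z\<close> is the inverse of \<open>z\<close>.\<close>
  have zw: "cnj z * w = 1 \<longleftrightarrow> w = z" for w
  proof -
    have "z * cnj z = 1" using assms by (simp add: complex_norm_square[symmetric])
    then show ?thesis by (metis mult.assoc mult.commute mult_1)
  qed
  have P_eigen: "blinfun_apply P x = (if w = z then x else 0)"
    if "x \<in> eigenspace U w" "cmod w = 1" for x w
    using LIMSEQ_unique[OF P ergodic_mean_eigenspace[OF that(1) cz that(2)]] by (simp add: zw)
  have in_eigenspace: "blinfun_apply P x \<in> eigenspace U z" for x
  proof (induction x rule: closed_additive_induct)
    case closed
    have "closed {x. blinfun_apply U (blinfun_apply P x) = z *\<^sub>C blinfun_apply P x}"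
      by (intro closed_Collect_eq continuous_intros
          bounded_linear.continuous_on[OF bounded_linear_scaleC_right])
    then show ?case by (simp add: eigenspace_def)
  next
    case (add x y)
    then show ?case by (simp add: eigenspace_def blinfun.add_right scaleC_add_right)
  next
    case (eigen x w)
    then show ?case using P_eigen[of x w] by auto
  qed
  have orth: "cinner y (x - blinfun_apply P x) = 0" if y: "y \<in> eigenspace U z" for x y
  proof (induction x rule: closed_additive_induct)
    case closed
    show ?case
      by (intro closed_Collect_eq continuous_intros
          continuous_on_compose2[OF continuous_on_cinner_right[of UNIV]]) auto
  next
    case (add x1 x2)
    then show ?case
      by (simp add: cinner_diff_right cinner_add_right blinfun.add_right)
  next
    case (eigen x w)
    then show ?case
      using P_eigen[of x w] eigenspaces_orthogonal[OF y, of x w] by (simp split: if_splits)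
  qed
  have "eigenprojection U z = P"
    using in_eigenspace orth by (rule eigenprojection_eqI)
  then show "(\<lambda>N. ergodic_mean (cnj z) N x) \<longlonglongrightarrow> blinfun_apply (eigenprojection U z) x"
    and "blinfun_apply (eigenprojection U z) x \<in> eigenspace U z"
    and "y \<in> eigenspace U z \<Longrightarrow> cinner y (x - blinfun_apply (eigenprojection U z) x) = 0"
    using P in_eigenspace orth by auto
qed

text \<open>If \<open>w = z\<close>, then \<open>x - ?p\<close> is in the eigenspace and orthogonal
  to it. Otherwise \<open>?p\<close> is orthogonal both to \<open>x\<close> and to
  \<open>x - ?p\<close>, hence to itself.\<close>

lemma eigenprojection_eigenspace:
  assumes "cmod z = 1" "x \<in> eigenspace U w"
  shows "blinfun_apply (eigenprojection U z) x = (if w = z then x else 0)"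
proof -
  let ?p = "blinfun_apply (eigenprojection U z) x"
  note p = eigenprojection_in_eigenspace[OF assms(1), of x]
  show ?thesis
  proof (cases "w = z")
    case True
    then have "x - ?p \<in> eigenspace U z" using p assms by (simp add: eigenspace_diff)
    then have "cinner (x - ?p) (x - ?p) = 0" by (rule eigenprojection_orthogonal[OF assms(1)])
    then show ?thesis using True by (simp add: cinner_eq_zero_iff)
  next
    case False
    then have "cinner ?p ?p = 0"
      using eigenprojection_orthogonal[OF assms(1) p, of x] eigenspaces_orthogonal[OF p assms(2)]
      by (simp add: cinner_diff_right)
    then show ?thesis using False by (simp add: cinner_eq_zero_iff)
  qed
qed

section \<open>Pythagoras, Bessel and the uniform bound on the partial sums\<close>

lemma norm_sum_eigenspaces:
  assumes "finite F" "\<And>z. z \<in> F \<Longrightarrow> v z \<in> eigenspace U z"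
  shows "(norm (\<Sum>z\<in>F. v z))\<^sup>2 = (\<Sum>z\<in>F. (norm (v z))\<^sup>2)"
  using assms by (intro norm_sum_power2_orthogonal) (auto intro: eigenspaces_orthogonal)

lemma bessel_eigenprojection:
  assumes "finite F" "F \<subseteq> sphere 0 1"
  shows "(\<Sum>z\<in>F. (norm (blinfun_apply (eigenprojection U z) x))\<^sup>2) \<le> (norm x)\<^sup>2"
proof -
  let ?p = "\<lambda>z. blinfun_apply (eigenprojection U z) x"
  define s where "s = (\<Sum>z\<in>F. ?p z)"
  have F: "cmod z = 1" if "z \<in> F" for z using assms that by auto
  have p: "?p z \<in> eigenspace U z" if "z \<in> F" for z
    using eigenprojection_in_eigenspace[OF F[OF that]] .
  \<comment> \<open>By orthogonality of the eigenspaces \<open>?p z\<close> only sees its own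
    summand of \<open>s\<close>, so the claim reduces to orthogonality to
    \<open>x - ?p z\<close>.\<close>
  have "cinner (?p z) (x - s) = 0" if "z \<in> F" for z
  proof -
    have "cinner (?p z) s = (\<Sum>w\<in>F. if w = z then cinner (?p z) (?p z) else 0)"
      unfolding s_def cinner_sum_right
      using eigenspaces_orthogonal[OF p p] that by (intro sum.cong refl) auto
    also have "\<dots> = cinner (?p z) (?p z)" using that assms(1) by simp
    finally show ?thesis
      using eigenprojection_orthogonal[OF F p, OF that that, of x] by (simp add: cinner_diff_right)
  qed
  then have "cinner s (x - s) = 0"
    by (subst s_def) (simp add: cinner_sum_left)
  then have "(norm x)\<^sup>2 = (norm s)\<^sup>2 + (norm (x - s))\<^sup>2"
    using norm_add_power2[of s "x - s"] by simp
  moreover have "(norm s)\<^sup>2 = (\<Sum>z\<in>F. (norm (?p z))\<^sup>2)"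
    unfolding s_def using assms(1) p by (rule norm_sum_eigenspaces)
  ultimately show ?thesis by simp
qed

lemma norm_eigenprojection_le:
  assumes "cmod z = 1"
  shows "norm (blinfun_apply (eigenprojection U z) x) \<le> norm x"
  by (rule power2_le_imp_le) (use bessel_eigenprojection[of "{z}" x] assms in simp_all)

text \<open>Pythagoras for the outputs, which lie in distinct eigenspaces, and Bessel for the inputs
  give a bound independent of \<open>F\<close>; summing norms termwise would not.\<close>

lemma norm_S_partial_le:
  assumes "finite F" "F \<subseteq> sphere 0 1"
  shows "norm (blinfun_apply (S_partial U A F) x) \<le> norm A * norm x"
proof -
  let ?q = "\<lambda>z. blinfun_apply (eigenprojection U (cnj z)) x"
  have F: "cmod z = 1" if "z \<in> F" for z using assms that by auto
  have "(norm (blinfun_apply (S_partial U A F) x))\<^sup>2 =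
      (\<Sum>z\<in>F. (norm (blinfun_apply (eigenprojection U z) (blinfun_apply A (?q z))))\<^sup>2)"
    unfolding S_partial_apply
    using assms(1) F by (intro norm_sum_eigenspaces eigenprojection_in_eigenspace) auto
  also have "\<dots> \<le> (\<Sum>z\<in>F. (norm A)\<^sup>2 * (norm (?q z))\<^sup>2)"
  proof (rule sum_mono)
    fix z assume "z \<in> F"
    have "norm (blinfun_apply (eigenprojection U z) (blinfun_apply A (?q z))) \<le> norm A * norm (?q z)"
      using norm_eigenprojection_le[OF F[OF \<open>z \<in> F\<close>]] norm_blinfun[of A] by (rule order_trans)
    then show "(norm (blinfun_apply (eigenprojection U z) (blinfun_apply A (?q z))))\<^sup>2
        \<le> (norm A)\<^sup>2 * (norm (?q z))\<^sup>2"
      by (metis power_mono norm_ge_zero power_mult_distrib)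
  qed
  also have "\<dots> = (norm A)\<^sup>2 * (\<Sum>w\<in>cnj ` F. (norm (blinfun_apply (eigenprojection U w) x))\<^sup>2)"
    by (simp add: sum_distrib_left sum.reindex inj_on_def)
  also have "\<dots> \<le> (norm A)\<^sup>2 * (norm x)\<^sup>2"
    using assms F by (intro mult_left_mono bessel_eigenprojection) auto
  finally show ?thesis
    by (metis power_mult_distrib power2_le_imp_le mult_nonneg_nonneg norm_ge_zero)
qed

section \<open>The averages of \<open>U^n A U^n\<close> and the identification of their
  limit\<close>

definition twisted_mean :: "('a \<Rightarrow>\<^sub>L 'a) \<Rightarrow> nat \<Rightarrow> 'a \<Rightarrow>\<^sub>L 'a" where
  "twisted_mean A N = (1 / real N) *\<^sub>R (\<Sum>n<N. blinfun_power U n o\<^sub>L A o\<^sub>L blinfun_power U n)"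

lemma norm_twisted_mean_le: "norm (blinfun_apply (twisted_mean A N) x) \<le> norm A * norm x"
proof -
  have "norm (blinfun_apply A (blinfun_apply (blinfun_power U n) x)) \<le> norm A * norm x" for n
    using norm_blinfun[of A "blinfun_apply (blinfun_power U n) x"] by simp
  then show ?thesis
    unfolding twisted_mean_def blinfun.scaleR_left blinfun.sum_left
    by (intro norm_mean_le) (simp only: blinfun_apply_blinfun_compose norm_blinfun_power)
qed

context
  fixes A :: "'a \<Rightarrow>\<^sub>L 'a"
  assumes A: "A \<in> bounded_operators"
begin

text \<open>By complex linearity of \<open>A\<close>, the inner power of \<open>U\<close>
  contributes a factor \<open>w ^ n\<close> that moves to the front. What remains is an ergodic mean
  of \<open>A x\<close> with weight \<open>w\<close>, written \<open>cnj (cnj w)\<close> to match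
  the projection for \<open>cnj w\<close>.\<close>

lemma twisted_mean_eigenspace:
  assumes "x \<in> eigenspace U w" "cmod w = 1"
  shows "(\<lambda>N. blinfun_apply (twisted_mean A N) x)
    \<longlonglongrightarrow> blinfun_apply (eigenprojection U (cnj w)) (blinfun_apply A x)"
proof -
  have "blinfun_apply (twisted_mean A N) x = ergodic_mean (cnj (cnj w)) N (blinfun_apply A x)" for N
    using A assms(1)
    by (simp add: twisted_mean_def ergodic_mean_def blinfun.scaleR_left blinfun.sum_left
        blinfun_power_eigenspace bounded_operators_def blinfun_power_scaleC)
  then show ?thesis
    using ergodic_mean_tendsto_eigenprojection[of "cnj w"] assms(2) by simp
qed

text \<open>The right-hand projection annihilates \<open>x\<close> unless \<open>z = cnj w\<close>,
  so at most one summand survives and the net is eventually constant.\<close>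

lemma S_partial_eigenspace:
  assumes x: "x \<in> eigenspace U w" and w: "cmod w = 1"
  shows "((\<lambda>F. blinfun_apply (S_partial U A F) x)
    \<longlongrightarrow> blinfun_apply (eigenprojection U (cnj w)) (blinfun_apply A x))
      (finite_subsets_at_top (sigma_pp_a U))"
proof (rule tendsto_eventually)
  let ?y = "blinfun_apply (eigenprojection U (cnj w)) (blinfun_apply A x)"
  \<comment> \<open>The threshold set is \<open>{cnj w}\<close> or empty, according to whether
    \<open>cnj w\<close> is an index of the sum; this treats both cases at once.\<close>
  let ?X = "{cnj w} \<inter> sigma_pp_a U"
  \<comment> \<open>A nonzero \<open>?y\<close> would be an eigenvector for \<open>cnj w\<close>,
    and \<open>x\<close> one for \<open>w\<close>; as \<open>cnj w * w = 1\<close>, this puts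
    \<open>cnj w\<close> into \<open>sigma_pp_a U\<close>.\<close>
  have outside: "?y = 0" if "cnj w \<notin> sigma_pp_a U"
  proof (rule ccontr)
    assume "?y \<noteq> 0"
    moreover from this have "x \<noteq> 0" by (auto simp: blinfun.zero_right)
    moreover have "?y \<in> eigenspace U (cnj w)"
      using w by (intro eigenprojection_in_eigenspace) simp
    moreover have "cnj w * w = 1"
      using w by (simp add: complex_norm_square[symmetric] mult.commute)
    ultimately show False
      using that x w unfolding sigma_pp_a_def sigma_pp_def by force
  qed
  have "finite F \<and> ?X \<subseteq> F \<and> F \<subseteq> sigma_pp_a U \<Longrightarrow> blinfun_apply (S_partial U A F) x = ?y" for F
  proof -
    assume F: "finite F \<and> ?X \<subseteq> F \<and> F \<subseteq> sigma_pp_a U"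
    have "blinfun_apply (S_partial U A F) x = (\<Sum>z\<in>F. if z = cnj w then ?y else 0)"
      unfolding S_partial_apply
    proof (rule sum.cong[OF refl])
      fix z assume "z \<in> F"
      then have "cmod (cnj z) = 1" using F by (auto simp: sigma_pp_a_def sigma_pp_def)
      from eigenprojection_eigenspace[OF this x]
      show "blinfun_apply (eigenprojection U z)
          (blinfun_apply A (blinfun_apply (eigenprojection U (cnj z)) x))
        = (if z = cnj w then ?y else 0)"
        by (auto simp: blinfun.zero_right)
    qed
    also have "\<dots> = ?y" using F outside by auto
    finally show ?thesis .
  qed
  then show "\<forall>\<^sub>F F in finite_subsets_at_top (sigma_pp_a U). blinfun_apply (S_partial U A F) x = ?y"
    unfolding eventually_finite_subsets_at_top by (intro exI[of _ ?X]) auto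
qed

lemma twisted_mean_limit:
  obtains S where "\<And>x. (\<lambda>N. blinfun_apply (twisted_mean A N) x) \<longlonglongrightarrow> blinfun_apply S x"
proof -
  have lin: "linear (blinfun_apply (twisted_mean A N))" for N
    by (simp add: bounded_linear.linear blinfun.bounded_linear_right)
  have "convergent (\<lambda>N. blinfun_apply (twisted_mean A N) x)" for x
  proof (induction x rule: closed_additive_induct)
    case closed
    show ?case by (rule closed_convergent_equibounded[OF lin norm_twisted_mean_le])
  next
    case (add x y)
    then show ?case using convergent_add by (simp add: blinfun.add_right)
  next
    case (eigen x w)
    then show ?case using twisted_mean_eigenspace unfolding convergent_def by blast
  qed
  from pointwise_limit_blinfun[OF lin norm_twisted_mean_le this] that show thesis by blast
qed

text \<open>The differences \<open>S_partial U A F - S\<close> are equibounded and tend to 0 on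
  eigenvectors, where both limits are the same projection of \<open>A x\<close>. Existence of the
  strong sum thus follows from convergence of the averages.\<close>

lemma S_partial_tendsto_twisted_mean_limit:
  assumes S: "\<And>x. (\<lambda>N. blinfun_apply (twisted_mean A N) x) \<longlonglongrightarrow> blinfun_apply S x"
  shows "((\<lambda>F. blinfun_apply (S_partial U A F) x) \<longlongrightarrow> blinfun_apply S x)
    (finite_subsets_at_top (sigma_pp_a U))"
proof -
  let ?F = "finite_subsets_at_top (sigma_pp_a U)"
  have "((\<lambda>F. blinfun_apply (S_partial U A F - S) x) \<longlongrightarrow> 0) ?F"
  proof (induction x rule: closed_additive_induct)
    case closed
    show ?case
    proof (rule closed_tendsto_zero_equibounded)
      show "linear (blinfun_apply (S_partial U A F - S))" for F
        by (simp add: bounded_linear.linear blinfun.bounded_linear_right)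
      have "norm (blinfun_apply (S_partial U A F - S) x) \<le> (norm A + norm S) * norm x"
        if "finite F" "F \<subseteq> sigma_pp_a U" for F x
      proof -
        have "F \<subseteq> sphere 0 1" using that by (auto simp: sigma_pp_a_def sigma_pp_def)
        from norm_S_partial_le[OF that(1) this, of A x] show ?thesis
          using norm_blinfun[of S x]
            norm_triangle_ineq4[of "blinfun_apply (S_partial U A F) x" "blinfun_apply S x"]
          by (simp add: blinfun.diff_left distrib_right)
      qed
      then show "\<forall>\<^sub>F F in ?F. \<forall>x. norm (blinfun_apply (S_partial U A F - S) x)
          \<le> (norm A + norm S) * norm x"
        \<comment> \<open>The bound holds for all finite subsets of the index set, so the empty
          threshold suffices.\<close>
        unfolding eventually_finite_subsets_at_top by (intro exI[of _ "{}"]) auto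
    qed
  next
    case (add x y)
    then show ?case using tendsto_add by (fastforce simp: blinfun.add_right)
  next
    case (eigen x w)
    have "blinfun_apply S x = blinfun_apply (eigenprojection U (cnj w)) (blinfun_apply A x)"
      using LIMSEQ_unique[OF S twisted_mean_eigenspace] eigen by blast
    with S_partial_eigenspace[of x w] eigen show ?case
      by (simp add: blinfun.diff_left LIM_zero)
  qed
  then show ?thesis by (simp add: blinfun.diff_left LIM_zero_iff)
qed

end

end

theorem proposition3p1:
  fixes U A :: "'a::complex_hilbert_space \<Rightarrow>\<^sub>L 'a"
  assumes "unitary_operator U"
    and "generated_by_eigenvectors U"
    and "A \<in> bounded_operators"
  shows "limitin strong_operator_topology (S_partial U A) (S_op U A)
           (finite_subsets_at_top (sigma_pp_a U)) \<and>
         limitin strong_operator_topology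
           (\<lambda>N. (1 / real N) *\<^sub>R (\<Sum>n<N. blinfun_power U n o\<^sub>L A o\<^sub>L blinfun_power U n))
           (S_op U A) sequentially"
proof -
  interpret almost_periodic U
    using assms by unfold_locales
  obtain S where S: "\<And>x. (\<lambda>N. blinfun_apply (twisted_mean A N) x) \<longlonglongrightarrow> blinfun_apply S x"
    using twisted_mean_limit[OF assms(3)] by blast
  then have partial: "limitin strong_operator_topology (S_partial U A) S
      (finite_subsets_at_top (sigma_pp_a U))"
    unfolding limitin_strong_operator_topology_iff
    using S_partial_tendsto_twisted_mean_limit[OF assms(3)] by blast
  moreover have "limitin strong_operator_topology (twisted_mean A) S sequentially"
    using S by (simp add: limitin_strong_operator_topology_iff)
  \<comment> \<open>The limit of the partial sums identifies \<open>S_op U A\<close> with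
    \<open>S\<close>, which is also the limit of the averages.\<close>
  ultimately show ?thesis
    unfolding twisted_mean_def S_op_eqI[OF partial] by simp
qed

end
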